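(* Let $(X,\tau)$ be an uncountable regular open Whyburn space. The following are equivalent: (1) $X$ is $\Omega^s$-Lindel\"{o}f; (2) $X$ is $\mathcal{K}_{\Omega}$-Lindel\"{o}f; (3) $t(\mathbf{0},Q_p(X,\mathbb{R}))=\omega$; (4) $t(f,Q_p(X,\mathbb{R}))=\omega$ for every continuous $f:X\to\mathbb{R}$; (5) $t(Q_p(X,\mathbb{D}))=\omega$.
   Context: All spaces are assumed regular. A function $f:X\to Y$ is quasicontinuous if for every $x\in X$, every open $V\ni f(x)$ and every open $U\ni x$ there is a nonempty open $W\subseteq U$ with $f(W)\subseteq V$. $Q_p(X,Y)$ is the set of all quasicontinuous functions $X\to Y$ with the topology of pointwise convergence; $\mathbb{D}=\{0,1\}$ is the discrete two-point space; $\mathbf{0}$ is the constant zero function. A space $X$ is open Whyburn if for every open $A\subseteq X$ and every $x\in\overline{A}\setminus A$ there is an open $B\subseteq A$ with $\overline{B}\setminus A=\{x\}$. A set $A$ is minimally bounded if $A\subseteq\overline{\mathrm{Int}A}$ and $\mathrm{Int}\overline{A}\subseteq A$. $\Omega^s$ is the collection of covers of $X$ by minimally bounded sets that are $\omega$-covers (every finite subset of $X$ is contained in some member). $\mathcal{K}$ is the collection of families $\mathcal{U}$ of open subsets of $X$ with $X=\bigcup\{\overline{U}:U\in\mathcal{U}\}$; $\mathcal{K}_\Omega$ is the set of $\mathcal{U}\in\mathcal{K}$ such that no element of $\mathcal{U}$ is dense in $X$ and for every finite $F\subseteq X$ there is $U\in\mathcal{U}$ with $F\subseteq\overline{U}$.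 For a collection $\mathcal{P}$ of covers, $X$ is $\mathcal{P}$-Lindel\"{o}f if each element of $\mathcal{P}$ has a countable subfamily belonging to $\mathcal{P}$. For a space $Z$ and $z\in Z$, $t(z,Z)=\omega$ means: whenever $z\in\overline{A}$, there is a countable $B\subseteq A$ with $z\in\overline{B}$; $t(Z)=\omega$ means $t(z,Z)=\omega$ for all $z\in Z$. *)

theory Defs
  imports "HOL-Analysis.Analysis"
begin

definition quasicontinuous :: "'a topology \<Rightarrow> 'b topology \<Rightarrow> ('a \<Rightarrow> 'b) \<Rightarrow> bool" where
  "quasicontinuous X Y f \<longleftrightarrow>
     f ` topspace X \<subseteq> topspace Y \<and>
     (\<forall>x\<in>topspace X. \<forall>V U. openin Y V \<and> f x \<in> V \<and> openin X U \<and> x \<in> U \<longrightarrow>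
        (\<exists>W. openin X W \<and> W \<noteq> {} \<and> W \<subseteq> U \<and> f ` W \<subseteq> V))"

definition Qp :: "'a topology \<Rightarrow> 'b topology \<Rightarrow> ('a \<Rightarrow> 'b) topology" where
  "Qp X Y = subtopology (product_topology (\<lambda>_. Y) (topspace X))
               {f. f \<in> extensional (topspace X) \<and> quasicontinuous X Y f}"

definition open_whyburn :: "'a topology \<Rightarrow> bool" where
  "open_whyburn X \<longleftrightarrow>
     (\<forall>A x. openin X A \<and> x \<in> X closure_of A - A \<longrightarrow>
        (\<exists>B. openin X B \<and> B \<subseteq> A \<and> X closure_of B - A = {x}))"

definition minimally_bounded :: "'a topology \<Rightarrow> 'a set \<Rightarrow> bool" where
  "minimally_bounded X A \<longleftrightarrow>
     A \<subseteq> X closure_of (X interior_of A) \<and> X interior_of (X closure_of A) \<subseteq> A"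

definition Omega_s :: "'a topology \<Rightarrow> 'a set set set" where
  "Omega_s X = {\<U>. (\<forall>U\<in>\<U>. U \<subseteq> topspace X \<and> minimally_bounded X U) \<and>
                   \<Union>\<U> = topspace X \<and>
                   (\<forall>F. finite F \<and> F \<subseteq> topspace X \<longrightarrow> (\<exists>U\<in>\<U>. F \<subseteq> U))}"

definition K_fam :: "'a topology \<Rightarrow> 'a set set set" where
  "K_fam X = {\<U>. (\<forall>U\<in>\<U>. openin X U) \<and> topspace X = \<Union>{X closure_of U | U. U \<in> \<U>}}"

definition K_Omega :: "'a topology \<Rightarrow> 'a set set set" where
  "K_Omega X = {\<U>. \<U> \<in> K_fam X \<and> (\<forall>U\<in>\<U>. X closure_of U \<noteq> topspace X) \<and>
                   (\<forall>F. finite F \<and> F \<subseteq> topspace X \<longrightarrow> (\<exists>U\<in>\<U>. F \<subseteq> X closure_of U))}"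

definition P_Lindelof :: "'a set set set \<Rightarrow> bool" where
  "P_Lindelof P \<longleftrightarrow> (\<forall>\<U>\<in>P. \<exists>\<V>. \<V> \<subseteq> \<U> \<and> countable \<V> \<and> \<V> \<in> P)"

definition countable_tightness_at :: "'b topology \<Rightarrow> 'b \<Rightarrow> bool" where
  "countable_tightness_at Z z \<longleftrightarrow>
     (\<forall>A. A \<subseteq> topspace Z \<and> z \<in> Z closure_of A \<longrightarrow>
        (\<exists>B. B \<subseteq> A \<and> countable B \<and> z \<in> Z closure_of B))"

definition countable_tightness :: "'b topology \<Rightarrow> bool" where
  "countable_tightness Z \<longleftrightarrow> (\<forall>z\<in>topspace Z. countable_tightness_at Z z)"

definition D2 :: "real topology" where
  "D2 = discrete_topology {0, 1}"

end

theory Submission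
  imports Defs
begin

text \<open>In a regular open Whyburn space every finite subset \<open>F\<close> of a semi-open set \<open>A\<close> admits an open
  set \<open>B\<close> with \<open>F \<subseteq> cl B \<subseteq> A\<close>. This turns \<open>\<omega>\<close>-covers by minimally bounded sets, or by sets on which
  a quasicontinuous function is close to a continuous one, into families of open sets whose closures
  form an \<open>\<omega>\<close>-cover. Conversely, closures of open sets are minimally bounded, with quasicontinuous
  indicator functions.

  The delicate implication is from (2) to (5), where the limit function may be discontinuous. In an open
  Whyburn space, (2) forces closed nowhere dense sets to be countable, then the countable chain
  condition, and hence the hereditary Lindelof property; so the limit function has only countably many
  discontinuities, and these can be handled separately.\<close>

section \<open>Countable selection and families in \<open>K_Omega\<close>\<close>

lemma countable_select:
  assumes "countable W" "\<And>w. w \<in> W \<Longrightarrow> \<exists>a\<in>A. P w a"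
  shows "\<exists>C\<subseteq>A. countable C \<and> (\<forall>w\<in>W. \<exists>a\<in>C. P w a)"
proof -
  obtain c where "\<And>w. w \<in> W \<Longrightarrow> c w \<in> A \<and> P w (c w)"
    using assms(2) by metis
  then show ?thesis
    using assms(1) by (intro exI[of _ "c ` W"]) auto
qed

text \<open>Applied to singletons, the condition on finite sets yields the covering condition of
  \<open>K_fam\<close>.\<close>

lemma K_Omega_iff:
  "\<U> \<in> K_Omega X \<longleftrightarrow>
     (\<forall>U\<in>\<U>. openin X U \<and> X closure_of U \<noteq> topspace X) \<and>
     (\<forall>F. finite F \<and> F \<subseteq> topspace X \<longrightarrow> (\<exists>U\<in>\<U>. F \<subseteq> X closure_of U))"
proof -
  have covers: "topspace X = \<Union>{X closure_of U |U. U \<in> \<U>}"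
    if *: "\<forall>F. finite F \<and> F \<subseteq> topspace X \<longrightarrow> (\<exists>U\<in>\<U>. F \<subseteq> X closure_of U)"
  proof
    show "topspace X \<subseteq> \<Union>{X closure_of U |U. U \<in> \<U>}"
    proof
      fix x assume "x \<in> topspace X"
      then have "\<exists>U\<in>\<U>. {x} \<subseteq> X closure_of U" using *[rule_format, of "{x}"] by simp
      then show "x \<in> \<Union>{X closure_of U |U. U \<in> \<U>}" by auto
    qed
    show "\<Union>{X closure_of U |U. U \<in> \<U>} \<subseteq> topspace X"
      using closure_of_subset_topspace by fastforce
  qed
  show ?thesis
    unfolding K_Omega_def K_fam_def mem_Collect_eq ball_conj_distrib
    by (intro iffI conjI; elim conjE; (assumption | erule covers))
qed

lemma K_Omega_openin: "\<U> \<in> K_Omega X \<Longrightarrow> U \<in> \<U> \<Longrightarrow> openin X U"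
  unfolding K_Omega_iff by simp

lemma K_Omega_cover:
  assumes "\<U> \<in> K_Omega X" "finite F" "F \<subseteq> topspace X"
  obtains U where "U \<in> \<U>" "F \<subseteq> X closure_of U"
  using conjunct2[OF assms(1)[unfolded K_Omega_iff], rule_format, OF conjI[OF assms(2,3)]] that
  by (elim bexE)

lemma K_Omega_subfamily:
  assumes "\<U> \<in> K_Omega X" "\<W> \<subseteq> \<U>"
    and "\<And>F. finite F \<Longrightarrow> F \<subseteq> topspace X \<Longrightarrow> \<exists>U\<in>\<W>. F \<subseteq> X closure_of U"
  shows "\<W> \<in> K_Omega X"
  using assms unfolding K_Omega_iff by (simp add: subset_iff)

text \<open>The tool for extracting countable subsets of \<open>A\<close>. The open sets
  \<open>B\<close> with a witness in \<open>A\<close> form a family whose closures swallow all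
  finite sets; \<open>K_Omega\<close>-Lindelofness thins it to a countable family, and one witness
  per retained \<open>B\<close> suffices.\<close>

lemma K_Omega_Lindelof_select:
  assumes L: "P_Lindelof (K_Omega X)"
    and P: "\<And>F. finite F \<Longrightarrow> F \<subseteq> topspace X \<Longrightarrow>
               \<exists>B. \<exists>a\<in>A. openin X B \<and> P B a \<and> F \<subseteq> X closure_of B"
  obtains C where "C \<subseteq> A" "countable C"
    "\<And>F. finite F \<Longrightarrow> F \<subseteq> topspace X \<Longrightarrow> \<exists>B. \<exists>a\<in>C. openin X B \<and> P B a \<and> F \<subseteq> X closure_of B"
proof -
  define V where "V = {B. openin X B \<and> (\<exists>a\<in>A. P B a)}"
  show thesis
  \<comment> \<open>A dense member keeps \<open>V\<close> out of \<open>K_Omega X\<close>, but its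
    closure contains every finite set, so a single witness serves.\<close>
  proof (cases "\<exists>B\<in>V. X closure_of B = topspace X")
    case True
    then obtain B a where "openin X B" "a \<in> A" "P B a" "X closure_of B = topspace X"
      unfolding V_def by blast
    then show thesis by (intro that[of "{a}"]) auto
  next
    case False
    have "\<exists>U\<in>V. F \<subseteq> X closure_of U" if "finite F" "F \<subseteq> topspace X" for F
      using P[OF that] unfolding V_def by blast
    then have "V \<in> K_Omega X"
      using False unfolding K_Omega_iff by (auto simp: V_def)
    then obtain W where W: "W \<subseteq> V" "countable W" "W \<in> K_Omega X"
      using L unfolding P_Lindelof_def by blast
    have "\<exists>C\<subseteq>A. countable C \<and> (\<forall>w\<in>W. \<exists>a\<in>C. P w a)"
      using W by (intro countable_select) (auto simp: V_def)
    then obtain C where C: "C \<subseteq> A" "countable C" "\<And>w. w \<in> W \<Longrightarrow> \<exists>a\<in>C. P w a"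
      by blast
    show thesis
    proof (rule that[OF C(1,2)])
      fix F assume "finite F" "F \<subseteq> topspace X"
      then obtain U where "U \<in> W" "F \<subseteq> X closure_of U"
        using K_Omega_cover[OF W(3)] by blast
      then show "\<exists>B. \<exists>a\<in>C. openin X B \<and> P B a \<and> F \<subseteq> X closure_of B"
        using C(3) W(1) unfolding V_def by blast
    qed
  qed
qed

section \<open>Closures of open sets as minimally bounded sets\<close>

lemma minimally_bounded_closure_of_open:
  assumes "openin X U"
  shows "minimally_bounded X (X closure_of U)"
proof -
  have "U \<subseteq> X interior_of (X closure_of U)"
    by (simp add: assms closure_of_subset interior_of_maximal openin_subset)
  then show ?thesis
    unfolding minimally_bounded_def by (simp add: closure_of_mono interior_of_subset)
qed

text \<open>Closures of the members of a family in \<open>K_Omega X\<close> form an omega-cover by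
  minimally bounded sets. Countably many of these closures come from countably many of the open
  sets, and non-density passes to subfamilies.\<close>

lemma Omega_s_Lindelof_imp_K_Omega_Lindelof:
  assumes "P_Lindelof (Omega_s X)"
  shows "P_Lindelof (K_Omega X)"
  unfolding P_Lindelof_def
proof
  fix \<U> assume U: "\<U> \<in> K_Omega X"
  have "(\<lambda>U. X closure_of U) ` \<U> \<in> Omega_s X"
    unfolding Omega_s_def
  proof (intro CollectI conjI ballI allI impI)
    show "\<Union> ((closure_of) X ` \<U>) = topspace X"
      using U unfolding K_Omega_def K_fam_def by (simp add: Setcompr_eq_image)
    show "\<exists>V\<in>(closure_of) X ` \<U>. F \<subseteq> V" if F: "finite F \<and> F \<subseteq> topspace X" for F
    proof -
      obtain W where "W \<in> \<U>" "F \<subseteq> X closure_of W"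
        by (rule K_Omega_cover[OF U conjunct1[OF F] conjunct2[OF F]])
      then show ?thesis by auto
    qed
    fix V assume "V \<in> (closure_of) X ` \<U>"
    then obtain U where "openin X U" "V = X closure_of U" using K_Omega_openin[OF U] by blast
    then show "V \<subseteq> topspace X" "minimally_bounded X V"
      by (auto simp: minimally_bounded_closure_of_open closure_of_subset_topspace)
  qed
  then obtain \<V> where V: "\<V> \<subseteq> (\<lambda>U. X closure_of U) ` \<U>" "countable \<V>" "\<V> \<in> Omega_s X"
    using assms unfolding P_Lindelof_def by blast
  then obtain \<W> where W: "\<W> \<subseteq> \<U>" "countable \<W>" "\<V> = (\<lambda>U. X closure_of U) ` \<W>"
    by (metis countable_subset_image)
  have "\<exists>U\<in>\<W>. F \<subseteq> X closure_of U" if "finite F" "F \<subseteq> topspace X" for F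
    using V(3) that unfolding Omega_s_def W(3) by simp
  then have "\<W> \<in> K_Omega X" using K_Omega_subfamily[OF U W(1)] by simp
  with W show "\<exists>\<V>\<subseteq>\<U>. countable \<V> \<and> \<V> \<in> K_Omega X" by blast
qed

section \<open>Quasicontinuous functions and pointwise closure\<close>

lemma quasicontinuousD:
  assumes "quasicontinuous X Y f" "x \<in> topspace X" "openin Y V" "f x \<in> V" "openin X U" "x \<in> U"
  obtains W where "openin X W" "W \<noteq> {}" "W \<subseteq> U" "f ` W \<subseteq> V"
  using assms(1)[unfolded quasicontinuous_def, THEN conjunct2, rule_format,
      OF assms(2) conjI[OF assms(3) conjI[OF assms(4) conjI[OF assms(5,6)]]]] that
  by (elim exE conjE)

lemma quasicontinuous_in_topspace:
  assumes "quasicontinuous X Y f" "x \<in> topspace X"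
  shows "f x \<in> topspace Y"
  using assms(1)[unfolded quasicontinuous_def, THEN conjunct1] assms(2)
  by (rule image_subset_iff[THEN iffD1, THEN bspec])

lemma topspace_Qp: "topspace (Qp X Y) = {f \<in> extensional (topspace X). quasicontinuous X Y f}"
  unfolding Qp_def by (auto simp: PiE_iff quasicontinuous_in_topspace intro: extensional_arb)

text \<open>Basic open sets of the product restrict only finitely many coordinates, so membership in
  a closure can be tested on finite sets.\<close>

lemma in_closure_of_Qp_iff:
  assumes f: "f \<in> topspace (Qp X Y)" and A: "A \<subseteq> topspace (Qp X Y)"
  shows "f \<in> Qp X Y closure_of A \<longleftrightarrow>
    (\<forall>F V. finite F \<and> F \<subseteq> topspace X \<and> (\<forall>x\<in>F. openin Y (V x) \<and> f x \<in> V x) \<longrightarrow>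
       (\<exists>g\<in>A. \<forall>x\<in>F. g x \<in> V x))" (is "?lhs \<longleftrightarrow> ?rhs")
proof
  assume L: ?lhs
  show ?rhs
  proof (intro allI impI, elim conjE)
    fix F V assume F: "finite F" "F \<subseteq> topspace X" "\<forall>x\<in>F. openin Y (V x) \<and> f x \<in> V x"
    define T where "T = Pi\<^sub>E (topspace X) (\<lambda>x. if x \<in> F then V x else topspace Y)"
    have "finite {i \<in> topspace X. (if i \<in> F then V i else topspace Y) \<noteq> topspace Y}"
      by (rule finite_subset[OF _ F(1)]) auto
    then have "openin (product_topology (\<lambda>_. Y) (topspace X)) T"
      unfolding T_def openin_PiE_gen using F(3) by simp
    then have "openin (Qp X Y) (T \<inter> {f. f \<in> extensional (topspace X) \<and> quasicontinuous X Y f})"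
      (is "openin _ ?T")
      unfolding Qp_def by (rule openin_subtopology_Int)
    moreover have "f \<in> {f. f \<in> extensional (topspace X) \<and> quasicontinuous X Y f}"
      using f unfolding topspace_Qp by simp
    moreover have "f \<in> T"
      using f F unfolding T_def topspace_Qp by (auto simp: PiE_iff quasicontinuous_in_topspace)
    ultimately have "f \<in> ?T \<and> openin (Qp X Y) ?T" by simp
    from L[unfolded in_closure_of, THEN conjunct2, rule_format, OF this]
    obtain g where "g \<in> A" "g \<in> T" by blast
    moreover have "\<forall>x\<in>F. g x \<in> V x"
    proof
      fix x assume "x \<in> F"
      then show "g x \<in> V x"
        using PiE_mem[OF \<open>g \<in> T\<close>[unfolded T_def], of x] F(2) by (auto simp: subset_iff)
    qed
    ultimately show "\<exists>g\<in>A. \<forall>x\<in>F. g x \<in> V x" by blast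
  qed
next
  assume R: ?rhs
  show ?lhs
    unfolding in_closure_of
  proof (intro conjI f allI impI, elim conjE)
    fix T assume T: "f \<in> T" "openin (Qp X Y) T"
    then obtain S where S: "openin (product_topology (\<lambda>_. Y) (topspace X)) S"
      "T = S \<inter> {f. f \<in> extensional (topspace X) \<and> quasicontinuous X Y f}"
      unfolding Qp_def openin_subtopology by (elim exE conjE)
    have "f \<in> S" using T(1) S(2) by simp
    from S(1)[unfolded openin_product_topology_alt, rule_format, OF this]
    obtain U where U: "finite {i \<in> topspace X. U i \<noteq> topspace Y}"
      "\<forall>i\<in>topspace X. openin Y (U i)" "f \<in> Pi\<^sub>E (topspace X) U" "Pi\<^sub>E (topspace X) U \<subseteq> S"
      by (elim exE conjE)
    \<comment> \<open>Outside \<open>F\<close> the box imposes only \<open>topspace Y\<close>, where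
      \<open>g\<close> takes its values anyway; so control on \<open>F\<close> puts \<open>g\<close>
      into the whole box.\<close>
    define F where "F = {i \<in> topspace X. U i \<noteq> topspace Y}"
    obtain g where g: "g \<in> A" "\<forall>x\<in>F. g x \<in> U x"
      using R[rule_format, of F U] U unfolding F_def by (auto simp: PiE_iff)
    have "g \<in> topspace (Qp X Y)" using g A by blast
    then have "g \<in> Pi\<^sub>E (topspace X) (\<lambda>_. topspace Y)"
      unfolding topspace_Qp by (auto simp: PiE_iff quasicontinuous_in_topspace)
    then have "g \<in> Pi\<^sub>E (topspace X) U"
      using g(2) unfolding F_def PiE_iff by blast
    then show "\<exists>y. y \<in> A \<and> y \<in> T"
      using g(1) U(4) S(2) \<open>g \<in> topspace (Qp X Y)\<close> unfolding topspace_Qp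
      by (intro exI[of _ g]) auto
  qed
qed

text \<open>Finitely many neighbourhoods of reals contain balls of one common radius.\<close>

lemma in_closure_of_Qp_real_iff:
  assumes f: "f \<in> topspace (Qp X euclideanreal)" and A: "A \<subseteq> topspace (Qp X euclideanreal)"
  shows "f \<in> Qp X euclideanreal closure_of A \<longleftrightarrow>
    (\<forall>F. \<forall>e>0. finite F \<and> F \<subseteq> topspace X \<longrightarrow> (\<exists>g\<in>A. \<forall>x\<in>F. \<bar>g x - f x\<bar> < e))"
  unfolding in_closure_of_Qp_iff[OF assms]
proof (intro iffI allI impI; elim conjE)
  fix F and e :: real
  assume R: "\<forall>F V. finite F \<and> F \<subseteq> topspace X \<and> (\<forall>x\<in>F. openin euclideanreal (V x) \<and> f x \<in> V x) \<longrightarrow>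
           (\<exists>g\<in>A. \<forall>x\<in>F. g x \<in> V x)" and "0 < e" "finite F" "F \<subseteq> topspace X"
  then show "\<exists>g\<in>A. \<forall>x\<in>F. \<bar>g x - f x\<bar> < e"
    using R[rule_format, of F "\<lambda>x. ball (f x) e"]
    by (auto simp: dist_real_def abs_minus_commute)
next
  fix F V
  assume R: "\<forall>F. \<forall>e>0. finite F \<and> F \<subseteq> topspace X \<longrightarrow> (\<exists>g\<in>A. \<forall>x\<in>F. \<bar>g x - f x\<bar> < e)"
    and F: "finite F" "F \<subseteq> topspace X" and V: "\<forall>x\<in>F. openin euclideanreal (V x) \<and> f x \<in> V x"
  have "\<forall>x\<in>F. \<exists>e>0. ball (f x) e \<subseteq> V x"
    using V by (simp add: open_contains_ball)
  then obtain d where d: "\<And>x. x \<in> F \<Longrightarrow> d x > 0 \<and> ball (f x) (d x) \<subseteq> V x" by metis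
  \<comment> \<open>\<open>insert 1\<close> keeps \<open>Min\<close> meaningful and positive when
    \<open>F\<close> is empty.\<close>
  define e where "e = Min (insert 1 (d ` F))"
  have "e > 0" "\<And>x. x \<in> F \<Longrightarrow> e \<le> d x" using F d unfolding e_def by auto
  then obtain g where g: "g \<in> A" "\<forall>x\<in>F. \<bar>g x - f x\<bar> < e" using R F by blast
  have "g x \<in> V x" if "x \<in> F" for x
  proof -
    have "\<bar>g x - f x\<bar> < d x" using g(2) that \<open>\<And>x. x \<in> F \<Longrightarrow> e \<le> d x\<close> by fastforce
    then have "g x \<in> ball (f x) (d x)" by (simp add: dist_real_def abs_minus_commute)
    then show ?thesis using d that by blast
  qed
  then show "\<exists>g\<in>A. \<forall>x\<in>F. g x \<in> V x" using g(1) by blast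
qed

text \<open>As \<open>f\<close> takes values in \<open>{0, 1}\<close>, the singletons
  \<open>{f x}\<close> are open in \<open>D2\<close>, and closeness to \<open>f\<close> on a finite
  set becomes equality.\<close>

lemma in_closure_of_Qp_D2_iff:
  assumes f: "f \<in> topspace (Qp X D2)" and A: "A \<subseteq> topspace (Qp X D2)"
  shows "f \<in> Qp X D2 closure_of A \<longleftrightarrow>
    (\<forall>F. finite F \<and> F \<subseteq> topspace X \<longrightarrow> (\<exists>g\<in>A. \<forall>x\<in>F. g x = f x))"
  unfolding in_closure_of_Qp_iff[OF assms]
proof (intro iffI allI impI; elim conjE)
  fix F
  assume R: "\<forall>F V. finite F \<and> F \<subseteq> topspace X \<and> (\<forall>x\<in>F. openin D2 (V x) \<and> f x \<in> V x) \<longrightarrow>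
           (\<exists>g\<in>A. \<forall>x\<in>F. g x \<in> V x)" and F: "finite F" "F \<subseteq> topspace X"
  have "\<forall>x\<in>F. f x \<in> {0, 1}"
    using f F quasicontinuous_in_topspace[of X D2 f] unfolding topspace_Qp D2_def by auto
  then show "\<exists>g\<in>A. \<forall>x\<in>F. g x = f x"
    using R[rule_format, of F "\<lambda>x. {f x}"] F by (auto simp: D2_def)
next
  fix F V
  assume R: "\<forall>F. finite F \<and> F \<subseteq> topspace X \<longrightarrow> (\<exists>g\<in>A. \<forall>x\<in>F. g x = f x)"
    and F: "finite F" "F \<subseteq> topspace X" and V: "\<forall>x\<in>F. openin D2 (V x) \<and> f x \<in> V x"
  obtain g where "g \<in> A" "\<forall>x\<in>F. g x = f x" using R F by blast
  with V show "\<exists>g\<in>A. \<forall>x\<in>F. g x \<in> V x" by (intro bexI[of _ g]) auto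
qed

text \<open>Every neighbourhood of a point of the preimage contains a nonempty open set mapped into
  \<open>V\<close>, and such a set lies in the interior of the preimage.\<close>

lemma quasicontinuous_vimage_semi_open:
  assumes "quasicontinuous X Y g" "openin Y V"
  shows "{x \<in> topspace X. g x \<in> V} \<subseteq> X closure_of (X interior_of {x \<in> topspace X. g x \<in> V})"
    (is "?S \<subseteq> _")
proof
  fix x assume x: "x \<in> ?S"
  show "x \<in> X closure_of (X interior_of ?S)"
    unfolding in_closure_of
  proof (intro conjI allI impI)
    fix T assume "x \<in> T \<and> openin X T"
    then obtain W where W: "openin X W" "W \<noteq> {}" "W \<subseteq> T" "g ` W \<subseteq> V"
      using x by (auto intro: quasicontinuousD[OF assms(1) _ assms(2)])
    then have "W \<subseteq> ?S" using openin_subset by fastforce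
    then have "W \<subseteq> X interior_of ?S" using W(1) by (simp add: interior_of_maximal)
    then show "\<exists>y. y \<in> X interior_of ?S \<and> y \<in> T" using W by blast
  qed (use x in auto)
qed

lemma quasicontinuous_const: "c \<in> topspace Y \<Longrightarrow> quasicontinuous X Y (restrict (\<lambda>_. c) (topspace X))"
  unfolding quasicontinuous_def
proof (intro conjI ballI allI impI)
  fix x V U
  assume "openin Y V \<and> restrict (\<lambda>_. c) (topspace X) x \<in> V \<and> openin X U \<and> x \<in> U" "x \<in> topspace X"
  then show "\<exists>W. openin X W \<and> W \<noteq> {} \<and> W \<subseteq> U \<and> restrict (\<lambda>_. c) (topspace X) ` W \<subseteq> V"
    using openin_subset by (intro exI[of _ U]) fastforce
qed auto

text \<open>Every neighbourhood of a point of the closure meets \<open>U\<close> in an open set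
  where the value is 0; off the closure the value is 1 on an open set. A general \<open>Y\<close>
  allows both \<open>euclideanreal\<close> and \<open>D2\<close>.\<close>

lemma quasicontinuous_indicator_closure_of:
  fixes Y :: "real topology"
  assumes U: "openin X U" and Y: "0 \<in> topspace Y" "1 \<in> topspace Y"
  shows "quasicontinuous X Y (\<lambda>x\<in>topspace X. if x \<in> X closure_of U then 0 else 1)"
    (is "quasicontinuous X Y ?g")
  unfolding quasicontinuous_def
proof (intro conjI ballI allI impI)
  fix x V T assume x: "x \<in> topspace X" and T: "openin Y V \<and> ?g x \<in> V \<and> openin X T \<and> x \<in> T"
  show "\<exists>W. openin X W \<and> W \<noteq> {} \<and> W \<subseteq> T \<and> ?g ` W \<subseteq> V"
  proof (cases "x \<in> X closure_of U")
    case True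
    have "U \<subseteq> X closure_of U" "U \<subseteq> topspace X"
      using U openin_subset[OF U] closure_of_subset by auto
    then have "?g ` (T \<inter> U) \<subseteq> V" using x T True by auto
    moreover have "T \<inter> U \<noteq> {}" using True T unfolding in_closure_of by blast
    ultimately show ?thesis using U T by (intro exI[of _ "T \<inter> U"]) auto
  next
    case False
    have "openin X (T - X closure_of U)" using T by (simp add: openin_diff)
    moreover have "?g ` (T - X closure_of U) \<subseteq> V"
      using False T x openin_subset[of X T] by auto
    ultimately show ?thesis using T False by (intro exI[of _ "T - X closure_of U"]) auto
  qed
qed (use Y in auto)

section \<open>From tightness at the zero function to \<open>K_Omega\<close>-Lindelofness\<close>

text \<open>Let \<open>g U\<close> vanish exactly on the closure of \<open>U\<close> and be 1
  elsewhere. Since the closures swallow finite sets, zero is in the closure of these functions.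
  Tightness leaves countably many of them, and as \<open>V\<close> separates 0 from 1,
  \<open>g U x \<in> V\<close> puts \<open>x\<close> back into the closure of
  \<open>U\<close>.\<close>

lemma countable_tightness_at_zero_imp_K_Omega_Lindelof:
  fixes Y :: "real topology"
  assumes Y: "0 \<in> topspace Y" "1 \<in> topspace Y" and V: "openin Y V" "0 \<in> V" "1 \<notin> V"
    and t: "countable_tightness_at (Qp X Y) (restrict (\<lambda>_. 0) (topspace X))"
  shows "P_Lindelof (K_Omega X)"
  unfolding P_Lindelof_def
proof
  fix \<U> assume U: "\<U> \<in> K_Omega X"
  let ?z = "restrict (\<lambda>_. 0::real) (topspace X)"
  define g where "g U = (\<lambda>x\<in>topspace X. if x \<in> X closure_of U then 0 else 1 :: real)" for U
  have z: "?z \<in> topspace (Qp X Y)"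
    using quasicontinuous_const[OF Y(1)] by (auto simp: topspace_Qp)
  have gU: "g ` \<U> \<subseteq> topspace (Qp X Y)"
    unfolding topspace_Qp g_def
    by (auto intro!: quasicontinuous_indicator_closure_of[OF _ Y] K_Omega_openin[OF U])
  have "?z \<in> Qp X Y closure_of (g ` \<U>)"
    unfolding in_closure_of_Qp_iff[OF z gU]
  proof (intro allI impI, elim conjE)
    fix F W assume F: "finite F" "F \<subseteq> topspace X" and W: "\<forall>x\<in>F. openin Y (W x) \<and> ?z x \<in> W x"
    obtain U where "U \<in> \<U>" "F \<subseteq> X closure_of U"
      using K_Omega_cover[OF U F] by blast
    then show "\<exists>h\<in>g ` \<U>. \<forall>x\<in>F. h x \<in> W x"
      using F W by (intro bexI[of _ "g U"]) (auto simp: g_def subset_iff)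
  qed
  from t[unfolded countable_tightness_at_def, rule_format, OF conjI[OF gU this]]
  obtain B where B: "B \<subseteq> g ` \<U>" "countable B" "?z \<in> Qp X Y closure_of B"
    by (elim exE conjE)
  then obtain \<W> where W: "\<W> \<subseteq> \<U>" "countable \<W>" "B = g ` \<W>"
    by (metis countable_subset_image)
  have BQ: "B \<subseteq> topspace (Qp X Y)" using B gU by blast
  have "\<exists>U\<in>\<W>. F \<subseteq> X closure_of U" if F: "finite F" "F \<subseteq> topspace X" for F
  proof -
    have "finite F \<and> F \<subseteq> topspace X \<and> (\<forall>x\<in>F. openin Y V \<and> ?z x \<in> V)"
      using F V by (auto simp: subset_iff)
    then obtain U where "U \<in> \<W>" "\<forall>x\<in>F. g U x \<in> V"
      using B(3)[unfolded in_closure_of_Qp_iff[OF z BQ], rule_format, of F "\<lambda>_. V"] W(3)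
      by blast
    then show ?thesis using F(2) V(3) unfolding g_def by (intro bexI[of _ U]) (auto split: if_splits)
  qed
  then have "\<W> \<in> K_Omega X" using K_Omega_subfamily[OF U W(1)] by simp
  with W show "\<exists>\<V>\<subseteq>\<U>. countable \<V> \<and> \<V> \<in> K_Omega X" by blast
qed

section \<open>Quasicontinuous functions near a continuous one\<close>

lemma quasicontinuous_of_continuous_map:
  assumes "continuous_map X Y f"
  shows "quasicontinuous X Y (restrict f (topspace X))"
  unfolding quasicontinuous_def
proof (intro conjI ballI allI impI)
  fix x V U assume x: "x \<in> topspace X"
    and V: "openin Y V \<and> restrict f (topspace X) x \<in> V \<and> openin X U \<and> x \<in> U"
  have "openin X (U \<inter> {y \<in> topspace X. f y \<in> V})"
    using assms V openin_continuous_map_preimage by blast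
  then show "\<exists>W. openin X W \<and> W \<noteq> {} \<and> W \<subseteq> U \<and> restrict f (topspace X) ` W \<subseteq> V"
    using x V by (intro exI[of _ "U \<inter> {y \<in> topspace X. f y \<in> V}"]) auto
qed (use assms in \<open>auto simp: continuous_map_def\<close>)

text \<open>The slack at \<open>x\<close> is halved: continuity keeps \<open>f\<close> within
  \<open>d\<close> on a whole neighbourhood, and quasicontinuity keeps \<open>g\<close> within
  \<open>d\<close> on a nonempty open subset of it.\<close>

lemma semi_open_quasicontinuous_near_continuous:
  fixes f g :: "'a \<Rightarrow> real"
  assumes f: "continuous_map X euclideanreal f" and g: "quasicontinuous X euclideanreal g"
  shows "{x \<in> topspace X. \<bar>g x - f x\<bar> < e}
           \<subseteq> X closure_of (X interior_of {x \<in> topspace X. \<bar>g x - f x\<bar> < e})" (is "?S \<subseteq> _")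
proof
  fix x assume x: "x \<in> ?S"
  define d where "d = (e - \<bar>g x - f x\<bar>) / 2"
  have d: "d > 0" using x by (auto simp: d_def)
  show "x \<in> X closure_of (X interior_of ?S)"
    unfolding in_closure_of
  proof (intro conjI allI impI)
    fix T assume T: "x \<in> T \<and> openin X T"
    have "openin X (T \<inter> {y \<in> topspace X. f y \<in> ball (f x) d})"
      using f T openin_continuous_map_preimage[OF f, of "ball (f x) d"] by auto
    moreover have "openin euclideanreal (ball (g x) d)" "g x \<in> ball (g x) d"
      "x \<in> T \<inter> {y \<in> topspace X. f y \<in> ball (f x) d}"
      using d x T by auto
    ultimately obtain W where W: "openin X W" "W \<noteq> {}"
      "W \<subseteq> T \<inter> {y \<in> topspace X. f y \<in> ball (f x) d}" "g ` W \<subseteq> ball (g x) d"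
      using x quasicontinuousD[OF g, of x] by (metis (no_types, lifting) mem_Collect_eq)
    have "W \<subseteq> ?S"
    proof
      fix y assume "y \<in> W"
      then have "y \<in> topspace X" "\<bar>f x - f y\<bar> < d" "\<bar>g x - g y\<bar> < d"
        using W(3,4) by (auto simp: dist_real_def)
      then show "y \<in> ?S" unfolding d_def by (auto simp: abs_if split: if_splits)
    qed
    then have "W \<subseteq> X interior_of ?S" using W(1) by (simp add: interior_of_maximal)
    then show "\<exists>y. y \<in> X interior_of ?S \<and> y \<in> T" using W by blast
  qed (use x in auto)
qed

section \<open>Finite subsets of semi-open sets\<close>

locale regular_open_whyburn =
  fixes X :: "'a topology"
  assumes regular: "regular_space X" and whyburn: "open_whyburn X"
begin

lemma open_closure_in_open:
  assumes "openin X U" "x \<in> U"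
  obtains B where "openin X B" "x \<in> B" "X closure_of B \<subseteq> U"
proof -
  have "neighbourhood_base_of (closedin X) X" using regular neighbourhood_base_of_closedin by blast
  then obtain B C where "openin X B" "closedin X C" "x \<in> B" "B \<subseteq> C" "C \<subseteq> U"
    using assms unfolding neighbourhood_base_of by metis
  then show thesis using that[of B] closure_of_minimal by (metis subset_trans)
qed

text \<open>Regularity settles interior points. Any other point of \<open>A\<close> is a limit of
  the interior, and open Whyburn gives an open set whose closure leaves the interior at
  \<open>x\<close> only.\<close>

lemma open_closure_in_semi_open_point:
  assumes A: "A \<subseteq> X closure_of (X interior_of A)" and x: "x \<in> A"
  shows "\<exists>B. openin X B \<and> x \<in> X closure_of B \<and> X closure_of B \<subseteq> A"
proof (cases "x \<in> X interior_of A")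
  case True
  then obtain B where B: "openin X B" "x \<in> B" "X closure_of B \<subseteq> X interior_of A"
    using open_closure_in_open[OF openin_interior_of] by blast
  then show ?thesis
    using closure_of_subset[OF openin_subset[OF B(1)]] interior_of_subset[of X A] by blast
next
  case False
  then have "x \<in> X closure_of (X interior_of A) - X interior_of A" using A x by blast
  from whyburn[unfolded open_whyburn_def, rule_format, OF conjI[OF openin_interior_of this]]
  obtain B where "openin X B" "X closure_of B - X interior_of A = {x}" by blast
  then show ?thesis using x interior_of_subset[of X A] by (intro exI[of _ B]) auto
qed

lemma open_closure_finite:
  assumes F: "finite F"
    and "\<And>x. x \<in> F \<Longrightarrow> \<exists>B. openin X B \<and> x \<in> X closure_of B \<and> X closure_of B \<subseteq> A"
  obtains B where "openin X B" "F \<subseteq> X closure_of B" "X closure_of B \<subseteq> A"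
proof -
  obtain b where b: "\<And>x. x \<in> F \<Longrightarrow> openin X (b x) \<and> x \<in> X closure_of (b x) \<and> X closure_of (b x) \<subseteq> A"
    using assms(2) by metis
  have "X closure_of (\<Union>(b ` F)) = \<Union>((\<lambda>x. X closure_of (b x)) ` F)"
    using closure_of_Union[of "b ` F" X] F by simp
  then show thesis using b by (intro that[of "\<Union>(b ` F)"]) auto
qed

lemma open_closure_in_semi_open:
  assumes "A \<subseteq> X closure_of (X interior_of A)" "finite F" "F \<subseteq> A"
  obtains B where "openin X B" "F \<subseteq> X closure_of B" "X closure_of B \<subseteq> A"
  by (rule open_closure_finite[OF assms(2) open_closure_in_semi_open_point[OF assms(1) subsetD[OF assms(3)]]])

text \<open>Selection is applied with the members of the cover as witnesses: a member containing
  \<open>F\<close> is semi-open, so it contains the closure of an open set whose closure contains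
  \<open>F\<close>.\<close>

lemma K_Omega_Lindelof_imp_Omega_s_Lindelof:
  assumes L: "P_Lindelof (K_Omega X)"
  shows "P_Lindelof (Omega_s X)"
  unfolding P_Lindelof_def
proof
  fix \<U> assume U: "\<U> \<in> Omega_s X"
  have "\<exists>B. \<exists>U\<in>\<U>. openin X B \<and> X closure_of B \<subseteq> U \<and> F \<subseteq> X closure_of B"
    if F: "finite F" "F \<subseteq> topspace X" for F
  proof -
    have "\<exists>U\<in>\<U>. F \<subseteq> U" using U F by (simp add: Omega_s_def)
    then obtain U where FU: "U \<in> \<U>" "F \<subseteq> U" by blast
    then have "U \<subseteq> X closure_of (X interior_of U)"
      using U unfolding Omega_s_def minimally_bounded_def by simp
    then obtain B where "openin X B" "F \<subseteq> X closure_of B" "X closure_of B \<subseteq> U"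
      using open_closure_in_semi_open[OF _ F(1) FU(2)] by metis
    then show ?thesis using FU by blast
  qed
  from K_Omega_Lindelof_select[OF L, where P = "\<lambda>B U. X closure_of B \<subseteq> U", OF this]
  obtain \<V> where V: "\<V> \<subseteq> \<U>" "countable \<V>"
    "\<And>F. finite F \<Longrightarrow> F \<subseteq> topspace X \<Longrightarrow>
        \<exists>B. \<exists>U\<in>\<V>. openin X B \<and> X closure_of B \<subseteq> U \<and> F \<subseteq> X closure_of B"
    by blast
  have V3: "\<exists>U\<in>\<V>. F \<subseteq> U" if "finite F" "F \<subseteq> topspace X" for F
    using V(3)[OF that] by blast
  have "\<Union>\<V> = topspace X"
  proof
    have "U \<subseteq> topspace X" if "U \<in> \<U>" for U using U that by (simp add: Omega_s_def)
    then show "\<Union>\<V> \<subseteq> topspace X" using V(1) by blast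
    show "topspace X \<subseteq> \<Union>\<V>"
    proof
      fix x assume "x \<in> topspace X"
      then show "x \<in> \<Union>\<V>" using V3[of "{x}"] by auto
    qed
  qed
  moreover have "\<forall>U\<in>\<V>. U \<subseteq> topspace X \<and> minimally_bounded X U"
    using U V(1) unfolding Omega_s_def by auto
  ultimately have "\<V> \<in> Omega_s X" using V3 unfolding Omega_s_def by simp
  with V show "\<exists>\<V>\<subseteq>\<U>. countable \<V> \<and> \<V> \<in> Omega_s X" by blast
qed

section \<open>Tightness at continuous functions\<close>

text \<open>For a fixed error \<open>e\<close>, the sets where \<open>g\<close> is within
  \<open>e\<close> of \<open>f\<close> are semi-open, so selection finds countably many
  \<open>g\<close> that suffice for all finite sets. The countable sets for the errors
  \<open>1/(n+1)\<close> are then united.\<close>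

lemma K_Omega_Lindelof_imp_tightness_continuous:
  assumes L: "P_Lindelof (K_Omega X)" and f: "continuous_map X euclideanreal f"
  shows "countable_tightness_at (Qp X euclideanreal) (restrict f (topspace X))"
  unfolding countable_tightness_at_def
proof (intro allI impI, elim conjE)
  let ?f = "restrict f (topspace X)"
  fix A assume A: "A \<subseteq> topspace (Qp X euclideanreal)" "?f \<in> Qp X euclideanreal closure_of A"
  have fQ: "?f \<in> topspace (Qp X euclideanreal)"
    using quasicontinuous_of_continuous_map[OF f] by (auto simp: topspace_Qp)
  have *: "\<exists>C\<subseteq>A. countable C \<and> (\<forall>F. finite F \<and> F \<subseteq> topspace X \<longrightarrow> (\<exists>g\<in>C. \<forall>x\<in>F. \<bar>g x - f x\<bar> < e))"
    if e: "e > 0" for e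
  proof -
    let ?S = "\<lambda>g. {x \<in> topspace X. \<bar>g x - f x\<bar> < e}"
    have "\<exists>B. \<exists>g\<in>A. openin X B \<and> X closure_of B \<subseteq> ?S g \<and> F \<subseteq> X closure_of B"
      if F: "finite F" "F \<subseteq> topspace X" for F
    proof -
      obtain g where g: "g \<in> A" "\<forall>x\<in>F. \<bar>g x - ?f x\<bar> < e"
        using A(2)[unfolded in_closure_of_Qp_real_iff[OF fQ A(1)]] F e by blast
      have FS: "F \<subseteq> ?S g" using g F by (auto simp: subset_iff)
      have so: "?S g \<subseteq> X closure_of (X interior_of ?S g)"
        using g A(1) by (intro semi_open_quasicontinuous_near_continuous f) (auto simp: topspace_Qp)
      obtain B where "openin X B" "F \<subseteq> X closure_of B" "X closure_of B \<subseteq> ?S g"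
        by (rule open_closure_in_semi_open[OF so F(1) FS])
      then show ?thesis using g(1) by blast
    qed
    from K_Omega_Lindelof_select[OF L, where P = "\<lambda>B g. X closure_of B \<subseteq> ?S g", OF this]
    obtain C where "C \<subseteq> A" "countable C" "\<And>F. finite F \<Longrightarrow> F \<subseteq> topspace X \<Longrightarrow>
        \<exists>B. \<exists>g\<in>C. openin X B \<and> X closure_of B \<subseteq> ?S g \<and> F \<subseteq> X closure_of B"
      by blast
    then show ?thesis by (intro exI[of _ C]) (smt (verit) mem_Collect_eq subsetD)
  qed
  then have "\<forall>n. \<exists>C\<subseteq>A. countable C \<and> (\<forall>F. finite F \<and> F \<subseteq> topspace X \<longrightarrow>
      (\<exists>g\<in>C. \<forall>x\<in>F. \<bar>g x - f x\<bar> < inverse (real (Suc n))))"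
    by simp
  then obtain C where C: "\<And>n. C n \<subseteq> A" "\<And>n. countable (C n)"
    "\<And>n F. finite F \<Longrightarrow> F \<subseteq> topspace X \<Longrightarrow>
      (\<exists>g\<in>C n. \<forall>x\<in>F. \<bar>g x - f x\<bar> < inverse (real (Suc n)))"
    by metis
  have CA: "(\<Union>n. C n) \<subseteq> A" using C(1) by blast
  then have CQ: "(\<Union>n. C n) \<subseteq> topspace (Qp X euclideanreal)" using A(1) by blast
  have "?f \<in> Qp X euclideanreal closure_of (\<Union>n. C n)"
    unfolding in_closure_of_Qp_real_iff[OF fQ CQ]
  proof (intro allI impI, elim conjE)
    fix F and e :: real assume F: "e > 0" "finite F" "F \<subseteq> topspace X"
    obtain n where n: "inverse (real (Suc n)) < e" using reals_Archimedean[OF F(1)] by blast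
    obtain g where "g \<in> C n" "\<forall>x\<in>F. \<bar>g x - f x\<bar> < inverse (real (Suc n))"
      using C(3)[OF F(2,3)] by blast
    then show "\<exists>g\<in>\<Union>n. C n. \<forall>x\<in>F. \<bar>g x - ?f x\<bar> < e"
      using n F(3) by (intro bexI[of _ g]) (auto simp: subset_iff intro: less_trans)
  qed
  then show "\<exists>B\<subseteq>A. countable B \<and> ?f \<in> Qp X euclideanreal closure_of B"
    using CA C(2) by (intro exI[of _ "\<Union>n. C n"]) auto
qed

section \<open>Nowhere dense sets, disjoint open families and open covers\<close>

text \<open>The complement of \<open>N\<close> is open and dense, so open Whyburn gives for each
  \<open>x \<in> N\<close> an open set whose closure meets \<open>N\<close> in \<open>x\<close>
  only. Finite sets thus lie in closures with finite trace on \<open>N\<close>; selecting countably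
  many bounds \<open>G\<close> for these traces exhausts \<open>N\<close> by finite sets.\<close>

lemma K_Omega_Lindelof_imp_countable_nowhere_dense:
  assumes L: "P_Lindelof (K_Omega X)" and N: "closedin X N" "X interior_of N = {}"
  shows "countable N"
proof -
  let ?A = "{G. finite G \<and> G \<subseteq> N}"
  have U: "openin X (topspace X - N)" using N(1) by blast
  have "\<exists>B. \<exists>G\<in>?A. openin X B \<and> X closure_of B \<inter> N \<subseteq> G \<and> F \<subseteq> X closure_of B"
    if F: "finite F" "F \<subseteq> topspace X" for F
  proof -
    have "\<exists>B. openin X B \<and> x \<in> X closure_of B \<and> X closure_of B \<subseteq> (topspace X - N) \<union> (F \<inter> N)"
      if x: "x \<in> F" for x
    proof (cases "x \<in> N")
      case True
      have "X closure_of (topspace X - N) = topspace X"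
        using N(2) by (simp add: closure_of_complement)
      then have "x \<in> X closure_of (topspace X - N) - (topspace X - N)" using F x True by auto
      from whyburn[unfolded open_whyburn_def, rule_format, OF conjI[OF U this]]
      obtain B where "openin X B" "X closure_of B - (topspace X - N) = {x}" by blast
      then show ?thesis using True x closure_of_subset_topspace[of X B] by (intro exI[of _ B]) auto
    next
      case False
      then have "x \<in> topspace X - N" using F x by blast
      then obtain B where B: "openin X B" "x \<in> B" "X closure_of B \<subseteq> topspace X - N"
        by (rule open_closure_in_open[OF U])
      then show ?thesis using closure_of_subset[OF openin_subset[OF B(1)]]
        by (intro exI[of _ B]) auto
    qed
    then obtain B where "openin X B" "F \<subseteq> X closure_of B"
      "X closure_of B \<subseteq> (topspace X - N) \<union> (F \<inter> N)"
      using open_closure_finite[OF F(1)] by metis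
    then show ?thesis using F(1) by (intro exI[of _ B] bexI[of _ "F \<inter> N"]) auto
  qed
  from K_Omega_Lindelof_select[OF L, where P = "\<lambda>B G. X closure_of B \<inter> N \<subseteq> G", OF this]
  obtain C where C: "C \<subseteq> ?A" "countable C" "\<And>F. finite F \<Longrightarrow> F \<subseteq> topspace X \<Longrightarrow>
      \<exists>B. \<exists>G\<in>C. openin X B \<and> X closure_of B \<inter> N \<subseteq> G \<and> F \<subseteq> X closure_of B"
    by blast
  have "N \<subseteq> \<Union>C"
  proof
    fix x assume x: "x \<in> N"
    then have "{x} \<subseteq> topspace X" using N(1) closedin_subset by blast
    then obtain B G where "G \<in> C" "X closure_of B \<inter> N \<subseteq> G" "x \<in> X closure_of B"
      using C(3)[of "{x}"] by auto
    then show "x \<in> \<Union>C" using x by blast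
  qed
  moreover have "countable (\<Union>C)" using countable_UN[OF C(2), of "\<lambda>G. G"] C(1) by (auto intro: countable_finite)
  ultimately show ?thesis by (rule countable_subset)
qed

text \<open>If an open disjoint family were uncountable, it would split into uncountably many uncountable
  pieces. Each point of the (countable) boundary of the union lies in the closure of the union of all
  pieces but one, with at most one exception, so some piece can be left out without losing any
  boundary point. Adding finitely many members of this piece back gives a family in
  \<^const>\<open>K_Omega\<close> without a countable subfamily in \<^const>\<open>K_Omega\<close>.\<close>

lemma K_Omega_Lindelof_imp_ccc:
  assumes L: "P_Lindelof (K_Omega X)" and D: "\<And>D. D \<in> \<D> \<Longrightarrow> openin X D \<and> D \<noteq> {}"
    and disj: "pairwise disjnt \<D>"
  shows "countable \<D>"
proof (rule ccontr)
  assume unc: "uncountable \<D>"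
  define N where "N = X closure_of (\<Union>\<D>) - \<Union>\<D>"
  have openU: "openin X (\<Union>\<E>)" if "\<E> \<subseteq> \<D>" for \<E> using D that by blast
  have subU: "\<Union>\<E> \<subseteq> X closure_of (\<Union>\<E>)" if "\<E> \<subseteq> \<D>" for \<E>
    by (rule closure_of_subset[OF openin_subset[OF openU[OF that]]])
  have clN: "closedin X N" unfolding N_def by (rule closedin_diff[OF closedin_closure_of openU[OF subset_refl]])
  have "X interior_of N = {}"
  proof (rule ccontr)
    assume "X interior_of N \<noteq> {}"
    then obtain x where x: "x \<in> X interior_of N" by blast
    then have "x \<in> X closure_of (\<Union>\<D>)" using interior_of_subset[of X N] unfolding N_def by blast
    then obtain y where "y \<in> \<Union>\<D>" "y \<in> X interior_of N"
      using x openin_interior_of[of X N] unfolding in_closure_of by blast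
    then show False using interior_of_subset[of X N] unfolding N_def by blast
  qed
  then have cN: "countable N" using K_Omega_Lindelof_imp_countable_nowhere_dense[OF L clN] by blast
  have "infinite \<D>" using unc countable_finite by blast
  \<comment> \<open>An infinite set is equinumerous with its square; \<open>h\<close> cuts
    \<open>\<D>\<close> into disjoint blocks \<open>I \<xi>\<close>, each a copy of
    \<open>\<D>\<close>.\<close>
  from card_of_Times_same_infinite[OF this, folded card_of_ordIso]
  obtain h where h: "bij_betw h (\<D> \<times> \<D>) \<D>" by (elim exE)
  define I where "I \<xi> = (\<lambda>D. h (\<xi>, D)) ` \<D>" for \<xi>
  have ID: "I \<xi> \<subseteq> \<D>" if "\<xi> \<in> \<D>" for \<xi> using h that unfolding I_def bij_betw_def by blast
  have Iunc: "uncountable (I \<xi>)" if "\<xi> \<in> \<D>" for \<xi>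
  proof -
    have "inj_on (\<lambda>D. h (\<xi>, D)) \<D>" using h that unfolding bij_betw_def inj_on_def by blast
    then show ?thesis unfolding I_def using unc countable_image_inj_on by blast
  qed
  have Idisj: "I \<xi> \<inter> I \<eta> = {}" if "\<xi> \<in> \<D>" "\<eta> \<in> \<D>" "\<xi> \<noteq> \<eta>" for \<xi> \<eta>
    using h that unfolding I_def bij_betw_def inj_on_def by blast
  define bad where "bad x \<xi> \<longleftrightarrow> \<xi> \<in> \<D> \<and> x \<notin> X closure_of (\<Union>(\<D> - I \<xi>))" for x \<xi>
  have bad1: "\<xi> = \<eta>" if "x \<in> N" "bad x \<xi>" "bad x \<eta>" for x \<xi> \<eta>
  proof (rule ccontr)
    assume "\<xi> \<noteq> \<eta>"
    then have "\<Union>\<D> = \<Union>(\<D> - I \<xi>) \<union> \<Union>(\<D> - I \<eta>)"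
      using Idisj[of \<xi> \<eta>] that unfolding bad_def by blast
    then have "X closure_of (\<Union>\<D>) = X closure_of (\<Union>(\<D> - I \<xi>)) \<union> X closure_of (\<Union>(\<D> - I \<eta>))"
      by simp
    then show False using that unfolding bad_def N_def by blast
  qed
  \<comment> \<open>A point of \<open>N\<close> has at most one bad index, so the bad indices are
    countable and the uncountable \<open>\<D>\<close> contains a good one.\<close>
  have "{\<xi>. \<exists>x\<in>N. bad x \<xi>} \<subseteq> (\<lambda>x. THE \<xi>. bad x \<xi>) ` N"
  proof
    fix \<xi> assume "\<xi> \<in> {\<xi>. \<exists>x\<in>N. bad x \<xi>}"
    then obtain x where x: "x \<in> N" "bad x \<xi>" by blast
    then have "(THE \<xi>. bad x \<xi>) = \<xi>" using bad1 by (intro the_equality)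
    then show "\<xi> \<in> (\<lambda>x. THE \<xi>. bad x \<xi>) ` N" using x(1) by blast
  qed
  then have "countable {\<xi>. \<exists>x\<in>N. bad x \<xi>}" using cN by (meson countable_image countable_subset)
  then obtain \<xi> where \<xi>: "\<xi> \<in> \<D>" "\<And>x. x \<in> N \<Longrightarrow> \<not> bad x \<xi>"
    using unc by (metis (mono_tags, lifting) countable_subset mem_Collect_eq subsetI)
  define R where "R = topspace X - X closure_of (\<Union>\<D>)"
  define O' where "O' = \<Union>(\<D> - I \<xi>)"
  have opR: "openin X R" and opO: "openin X O'"
    unfolding R_def O'_def
    by (rule openin_diff[OF openin_topspace closedin_closure_of], rule openU[OF Diff_subset])
  have NO: "N \<subseteq> X closure_of O'" using \<xi> unfolding bad_def O'_def by blast
  \<comment> \<open>Only the points of \<open>\<Union>(I \<xi>)\<close> are left outside the closure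
    of \<open>R \<union> O'\<close>, and a finite set of them needs finitely many members of the
    block.\<close>
  let ?A = "{\<F>. finite \<F> \<and> \<F> \<subseteq> I \<xi>}"
  define P where "P B \<F> \<longleftrightarrow> B = R \<union> O' \<union> \<Union>\<F>" for B \<F>
  have "\<exists>B. \<exists>\<F>\<in>?A. openin X B \<and> P B \<F> \<and> F \<subseteq> X closure_of B"
    if F: "finite F" "F \<subseteq> topspace X" for F
  proof -
    define \<F> where "\<F> = {E \<in> I \<xi>. E \<inter> F \<noteq> {}}"
    have sub: "\<F> \<subseteq> \<D>" using ID[OF \<xi>(1)] unfolding \<F>_def by blast
    have "finite (\<Union>x\<in>F. {E \<in> \<D>. x \<in> E})"
    proof (rule finite_UN_I[OF F(1)])
      fix x
      show "finite {E \<in> \<D>. x \<in> E}"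
      proof (cases "{E \<in> \<D>. x \<in> E} = {}")
        case True
        then show ?thesis by (simp only: finite.emptyI)
      next
        case False
        then obtain E0 where E0: "E0 \<in> \<D>" "x \<in> E0" by blast
        have "E = E0" if "E \<in> \<D>" "x \<in> E" for E
          using disj that E0 unfolding pairwise_def disjnt_def by blast
        then have "{E \<in> \<D>. x \<in> E} \<subseteq> {E0}" by auto
        then show ?thesis by (rule finite_subset) simp
      qed
    qed
    moreover have "\<F> \<subseteq> (\<Union>x\<in>F. {E \<in> \<D>. x \<in> E})" using sub unfolding \<F>_def by blast
    ultimately have fin: "finite \<F>" by (rule rev_finite_subset)
    have op: "openin X (R \<union> O' \<union> \<Union>\<F>)" by (intro openin_Un opR opO openU[OF sub])
    have "F \<subseteq> R \<union> O' \<union> \<Union>\<F> \<union> N"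
      using F(2) unfolding R_def O'_def \<F>_def N_def by blast
    moreover have "N \<subseteq> X closure_of (R \<union> O' \<union> \<Union>\<F>)" using NO by auto
    ultimately have "F \<subseteq> X closure_of (R \<union> O' \<union> \<Union>\<F>)"
      using closure_of_subset[OF openin_subset[OF op]] by blast
    moreover have "\<F> \<in> ?A" using fin unfolding \<F>_def by blast
    ultimately show ?thesis using op unfolding P_def by blast
  qed
  from K_Omega_Lindelof_select[OF L, where P = P, OF this]
  obtain C where C: "C \<subseteq> ?A" "countable C" "\<And>F. finite F \<Longrightarrow> F \<subseteq> topspace X \<Longrightarrow>
      \<exists>B. \<exists>\<F>\<in>C. openin X B \<and> P B \<F> \<and> F \<subseteq> X closure_of B"
    by blast
  have "countable (\<Union>C)" using countable_UN[OF C(2), of "\<lambda>G. G"] C(1) by (auto intro: countable_finite)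
  \<comment> \<open>\<open>E\<close> escapes all selected subfamilies. Being open and disjoint from
    \<open>R\<close>, \<open>O'\<close> and their unions, it keeps its points out of every selected
    closure.\<close>
  then obtain E where E: "E \<in> I \<xi>" "E \<notin> \<Union>C"
    using Iunc[OF \<xi>(1)] by (meson countable_subset subsetI)
  then have ED: "E \<in> \<D>" using ID \<xi>(1) by blast
  then obtain x where x: "x \<in> E" using D by blast
  have "{x} \<subseteq> topspace X" using x D[OF ED] openin_subset by blast
  then obtain \<F> where F: "\<F> \<in> C" "x \<in> X closure_of (R \<union> O' \<union> \<Union>\<F>)" 
    using C(3)[of "{x}"] unfolding P_def by auto
  then obtain y where y: "y \<in> E" "y \<in> R \<union> O' \<union> \<Union>\<F>" using x D[OF ED] unfolding in_closure_of by blast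
  have "y \<notin> R" using y(1) ED subU[of \<D>] unfolding R_def by blast
  then obtain E' where E': "E' \<in> (\<D> - I \<xi>) \<union> \<F>" "y \<in> E'" using y(2) unfolding O'_def by blast
  have "\<F> \<subseteq> \<D>" "E \<notin> \<F>" using F(1) C(1) ID[OF \<xi>(1)] E by blast+
  then have "E' \<in> \<D>" "E \<noteq> E'" using E'(1) E(1) by auto
  then have "disjnt E E'" using disj ED by (simp add: pairwise_def)
  then show False using y(1) E'(2) by (simp add: disjnt_iff)
qed

text \<open>A maximal disjoint family of nonempty open sets refining \<open>\<C>\<close> is
  countable, so countably many members of \<open>\<C>\<close> cover its union. By maximality the
  rest of \<open>\<Union>\<C>\<close> is nowhere dense, hence countable, and is covered point by
  point.\<close>

lemma K_Omega_Lindelof_imp_hereditarily_Lindelof: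
  assumes L: "P_Lindelof (K_Omega X)" and C: "\<And>C. C \<in> \<C> \<Longrightarrow> openin X C"
  obtains \<C>' where "\<C>' \<subseteq> \<C>" "countable \<C>'" "\<Union>\<C>' = \<Union>\<C>"
proof -
  define Q where "Q = {\<D>. (\<forall>D\<in>\<D>. openin X D \<and> D \<noteq> {} \<and> (\<exists>C\<in>\<C>. D \<subseteq> C)) \<and> pairwise disjnt \<D>}"
  have "\<exists>M\<in>Q. \<forall>\<D>\<in>Q. M \<subseteq> \<D> \<longrightarrow> \<D> = M"
  proof (rule subset_Zorn')
    fix ch assume ch: "subset.chain Q ch"
    then have "ch \<subseteq> Q" "\<And>a b. a \<in> ch \<Longrightarrow> b \<in> ch \<Longrightarrow> a \<subseteq> b \<or> b \<subseteq> a"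
      unfolding subset.chain_def by auto
    \<comment> \<open>Two members of the union of a chain already lie in one family of the
      chain.\<close>
    moreover from this have "pairwise disjnt (\<Union>ch)"
      unfolding Q_def pairwise_def by (smt (verit) UnionE mem_Collect_eq subsetD)
    ultimately show "\<Union>ch \<in> Q" unfolding Q_def by blast
  qed
  then obtain \<D> where D: "\<D> \<in> Q" and max: "\<And>\<E>. \<E> \<in> Q \<Longrightarrow> \<D> \<subseteq> \<E> \<Longrightarrow> \<E> = \<D>" by blast
  have "countable \<D>" using D unfolding Q_def by (intro K_Omega_Lindelof_imp_ccc[OF L]) simp_all
  then have "\<exists>C1\<subseteq>\<C>. countable C1 \<and> (\<forall>D\<in>\<D>. \<exists>C\<in>C1. D \<subseteq> C)"
    by (rule countable_select) (use D in \<open>simp add: Q_def\<close>)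
  then obtain \<C>1 where C1: "\<C>1 \<subseteq> \<C>" "countable \<C>1" "\<And>D. D \<in> \<D> \<Longrightarrow> \<exists>C\<in>\<C>1. D \<subseteq> C"
    by blast
  define N where "N = X closure_of (\<Union>\<C>) - \<Union>\<D>"
  have opD: "openin X (\<Union>\<D>)" using D unfolding Q_def by (intro openin_Union) simp
  have "X interior_of N = {}"
  proof (rule ccontr)
    assume "X interior_of N \<noteq> {}"
    then obtain x where x: "x \<in> X interior_of N" by blast
    then have "x \<in> X closure_of (\<Union>\<C>)" using interior_of_subset[of X N] unfolding N_def by blast
    then obtain y C where y: "C \<in> \<C>" "y \<in> C" "y \<in> X interior_of N"
      using x openin_interior_of[of X N] unfolding in_closure_of by blast
    \<comment> \<open>An open piece of \<open>C\<close> inside \<open>N\<close> could be added to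
      \<open>\<D>\<close>, against maximality.\<close>
    define E where "E = C \<inter> X interior_of N"
    have E: "openin X E" "y \<in> E" "E \<subseteq> C" "E \<inter> \<Union>\<D> = {}"
      using y C interior_of_subset[of X N] unfolding E_def N_def by auto
    then have "insert E \<D> \<in> Q"
      using D y(1) unfolding Q_def by (auto simp: pairwise_insert disjnt_def)
    then have "E \<in> \<D>" using max by blast
    then show False using E by blast
  qed
  then have "countable N"
    using K_Omega_Lindelof_imp_countable_nowhere_dense[OF L, of N] closedin_diff[OF closedin_closure_of opD]
    unfolding N_def by simp
  then have "countable (N \<inter> \<Union>\<C>)" by (rule countable_subset[rotated]) blast
  then have "\<exists>C2\<subseteq>\<C>. countable C2 \<and> (\<forall>x\<in>N \<inter> \<Union>\<C>. \<exists>C\<in>C2. x \<in> C)"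
    by (rule countable_select) blast
  then obtain \<C>2 where C2: "\<C>2 \<subseteq> \<C>" "countable \<C>2" "\<And>x. x \<in> N \<inter> \<Union>\<C> \<Longrightarrow> \<exists>C\<in>\<C>2. x \<in> C"
    by blast
  have "\<Union>\<C> \<subseteq> X closure_of (\<Union>\<C>)"
    using C closure_of_subset openin_subset openin_Union by metis
  then have "\<Union>\<C> \<subseteq> \<Union>\<D> \<union> (N \<inter> \<Union>\<C>)" unfolding N_def by blast
  also have "\<dots> \<subseteq> \<Union>(\<C>1 \<union> \<C>2)" using C1(3) C2(3) by blast
  finally show thesis using C1 C2 by (intro that[of "\<C>1 \<union> \<C>2"]) auto
qed

section \<open>Tightness of the space of two-valued quasicontinuous functions\<close>

text \<open>The functions \<open>g\<close> may agree with \<open>f\<close> at a discontinuity of \<open>f\<close> but on no open set nearby, so the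
  set where \<open>g = f\<close> need not be semi-open there. The discontinuities form a closed nowhere dense, hence
  countable, set \<open>N\<close>; finite subsets of \<open>N\<close> are treated one by one, and the remaining points are
  covered with the help of open sets \<open>H s\<close> around \<open>N\<close> that avoid a given part of the complement.\<close>

lemma K_Omega_Lindelof_imp_tightness_D2:
  assumes L: "P_Lindelof (K_Omega X)"
  shows "countable_tightness (Qp X D2)"
  unfolding countable_tightness_def countable_tightness_at_def
proof (intro ballI allI impI, elim conjE)
  fix f A assume f: "f \<in> topspace (Qp X D2)" and A: "A \<subseteq> topspace (Qp X D2)"
    and fA: "f \<in> Qp X D2 closure_of A"
  have range: "g x = 0 \<or> g x = 1" if "g \<in> topspace (Qp X D2)" "x \<in> topspace X" for g x
    using that quasicontinuous_in_topspace[of X D2 g] unfolding topspace_Qp D2_def by auto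
  \<comment> \<open>\<open>J c\<close> is the interior of a level set, so \<open>N\<close> consists
    of the points where \<open>f\<close> is not locally constant.\<close>
  define J where "J c = X interior_of {x \<in> topspace X. f x = c}" for c
  define N where "N = topspace X - (J 0 \<union> J 1)"
  have J: "openin X (J c)" "J c \<subseteq> {x \<in> topspace X. f x = c}" for c
    unfolding J_def by (rule openin_interior_of, rule interior_of_subset)
  have opN: "openin X (topspace X - N)"
    and cN: "closedin X N"
    unfolding N_def using J(1)[of 0] J(1)[of 1] by (auto simp: openin_Un Diff_Diff_Int)
  have sl: "{x \<in> topspace X. g x = c} \<subseteq> X closure_of (X interior_of {x \<in> topspace X. g x = c})"
    if "g \<in> topspace (Qp X D2)" "c = 0 \<or> c = 1" for g c
    using quasicontinuous_vimage_semi_open[of X D2 g "{c}"] that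
    by (auto simp: topspace_Qp D2_def)
  \<comment> \<open>Level sets of \<open>f\<close> are semi-open, so each point is a limit of points
    where \<open>f\<close> is locally constant.\<close>
  have "X interior_of N = {}"
  proof (rule ccontr)
    assume "X interior_of N \<noteq> {}"
    then obtain x where x: "x \<in> X interior_of N" by blast
    then have xt: "x \<in> topspace X" using interior_of_subset_topspace by fastforce
    then have "x \<in> X closure_of J (f x)" unfolding J_def using sl[OF f range[OF f xt]] by blast
    then obtain y where "y \<in> J (f x)" "y \<in> X interior_of N"
      using x openin_interior_of[of X N] unfolding in_closure_of by blast
    then show False using interior_of_subset[of X N] range[OF f xt] unfolding N_def by auto
  qed
  then have Nc: "countable N" using K_Omega_Lindelof_imp_countable_nowhere_dense[OF L cN] by blast
  \<comment> \<open>By regularity, open sets with closure missing \<open>N\<close> cover the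
    complement of \<open>N\<close>. Keeping countably many makes the finite
    \<open>s \<subseteq> \<Z>\<close> countable in number.\<close>
  obtain \<Z> where Z: "\<Z> \<subseteq> {Z. openin X Z \<and> X closure_of Z \<inter> N = {}}" "countable \<Z>"
    "\<Union>\<Z> = \<Union>{Z. openin X Z \<and> X closure_of Z \<inter> N = {}}"
    using K_Omega_Lindelof_imp_hereditarily_Lindelof[OF L, of "{Z. openin X Z \<and> X closure_of Z \<inter> N = {}}"]
    by blast
  have Zcov: "topspace X - N \<subseteq> \<Union>\<Z>"
  proof
    fix x assume "x \<in> topspace X - N"
    then obtain B where "openin X B" "x \<in> B" "X closure_of B \<subseteq> topspace X - N"
      using open_closure_in_open[OF opN] by blast
    then show "x \<in> \<Union>\<Z>" unfolding Z(3) by blast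
  qed
  \<comment> \<open>\<open>H s\<close> is an open buffer that absorbs the points of
    \<open>N\<close>, while its closure stays off \<open>\<Union>s\<close>.\<close>
  define H where "H s = topspace X - X closure_of (\<Union>s)" for s
  have H: "openin X (H s)" "N \<subseteq> H s" "X closure_of (H s) \<inter> \<Union>s = {}" if s: "finite s" "s \<subseteq> \<Z>" for s
  proof -
    show "openin X (H s)" unfolding H_def by (rule openin_diff[OF openin_topspace closedin_closure_of])
    have "X closure_of (\<Union>s) \<inter> N = {}" using closure_of_Union[OF s(1), of X] s(2) Z(1) by auto
    then show "N \<subseteq> H s" using closedin_subset[OF cN] unfolding H_def by blast
    have os: "openin X (\<Union>s)" using s(2) Z(1) by blast
    have "H s \<inter> \<Union>s = {}" unfolding H_def using closure_of_subset[OF openin_subset[OF os]] by blast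
    then show "X closure_of (H s) \<inter> \<Union>s = {}"
      using openin_Int_closure_of_eq_empty[OF os, of "H s"] by blast
  qed
  define T where "T = {G. finite G \<and> G \<subseteq> N} \<times> {s. finite s \<and> s \<subseteq> \<Z>}"
  have "\<exists>C\<subseteq>A. countable C \<and> (\<forall>F. finite F \<and> F \<subseteq> (topspace X - N) \<inter> \<Union>s \<longrightarrow>
            (\<exists>g\<in>C. \<forall>x\<in>F \<union> G. g x = f x))"
    if "(G, s) \<in> T" for G s
  proof -
    have G: "finite G" "G \<subseteq> N" and s: "finite s" "s \<subseteq> \<Z>" using that unfolding T_def by auto
    \<comment> \<open>Agreement on \<open>G\<close> is demanded pointwise, as no open set need
      witness it. \<open>E\<close> serves the points outside \<open>N\<close>, and
      \<open>H s\<close> fills in \<open>N\<close> so that the closures swallow all finite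
      sets.\<close>
    define P where "P B g \<longleftrightarrow> (\<forall>x\<in>G. g x = f x) \<and>
        (\<exists>E. X closure_of E \<subseteq> {x \<in> topspace X. g x = f x} \<and> B = E \<union> H s)" for B g
    have "\<exists>B. \<exists>g\<in>A. openin X B \<and> P B g \<and> F \<subseteq> X closure_of B"
      if F: "finite F" "F \<subseteq> topspace X" for F
    proof -
      have "finite (F \<union> G)" "F \<union> G \<subseteq> topspace X"
        using F G closedin_subset[OF cN] by auto
      then obtain g where g: "g \<in> A" "\<forall>x\<in>F \<union> G. g x = f x"
        using fA[unfolded in_closure_of_Qp_D2_iff[OF f A]] by blast
      have gQ: "g \<in> topspace (Qp X D2)" using g A by blast
      \<comment> \<open>Outside \<open>N\<close>, \<open>f\<close> is constant on the open set
        \<open>J (f x)\<close>; the agreement set there is a level set of \<open>g\<close> cut by an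
        open set, hence semi-open.\<close>
      have near: "\<exists>B. openin X B \<and> x \<in> X closure_of B \<and> X closure_of B \<subseteq> {x \<in> topspace X. g x = f x}"
        if x: "x \<in> F - N" for x
      proof -
        have xt: "x \<in> topspace X" using x F by blast
        let ?S = "J (f x) \<inter> {y \<in> topspace X. g y = f x}"
        have "x \<in> ?S" using x xt g(2) J(2)[of 0] J(2)[of 1] unfolding N_def by auto
        moreover have "?S \<subseteq> X closure_of (X interior_of ?S)"
        proof -
          have "?S \<subseteq> J (f x) \<inter> X closure_of (X interior_of {y \<in> topspace X. g y = f x})"
            using sl[OF gQ range[OF f xt]] by blast
          also have "\<dots> \<subseteq> X closure_of (J (f x) \<inter> X interior_of {y \<in> topspace X. g y = f x})"
            by (simp add: J(1) openin_Int_closure_of_subset)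
          also have "\<dots> = X closure_of (X interior_of ?S)"
            by (simp add: J(1) interior_of_Int interior_of_openin)
          finally show ?thesis .
        qed
        ultimately obtain B where "openin X B" "x \<in> X closure_of B" "X closure_of B \<subseteq> ?S"
          using open_closure_in_semi_open_point by blast
        moreover have "?S \<subseteq> {x \<in> topspace X. g x = f x}" using J(2)[of "f x"] by auto
        ultimately show ?thesis by (meson subset_trans)
      qed
      obtain E where E: "openin X E" "F - N \<subseteq> X closure_of E"
        "X closure_of E \<subseteq> {x \<in> topspace X. g x = f x}"
        by (rule open_closure_finite[OF finite_Diff[OF F(1)] near])
      have "F \<subseteq> X closure_of (E \<union> H s)"
        using E(2) H(2)[OF s] closure_of_subset[OF openin_subset[OF H(1)[OF s]]] by auto
      then show ?thesis
        using E g H(1)[OF s] unfolding P_def by (intro exI[of _ "E \<union> H s"] bexI[of _ g]) auto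
    qed
    from K_Omega_Lindelof_select[OF L, where P = P, OF this]
    obtain C where C: "C \<subseteq> A" "countable C" "\<And>F. finite F \<Longrightarrow> F \<subseteq> topspace X \<Longrightarrow>
        \<exists>B. \<exists>g\<in>C. openin X B \<and> P B g \<and> F \<subseteq> X closure_of B"
      by blast
    have "\<exists>g\<in>C. \<forall>x\<in>F \<union> G. g x = f x" if F: "finite F" "F \<subseteq> (topspace X - N) \<inter> \<Union>s" for F
    proof -
      have "F \<subseteq> topspace X" using F by blast
      from C(3)[OF F(1) this] obtain g E where g: "g \<in> C" "\<forall>x\<in>G. g x = f x"
        "X closure_of E \<subseteq> {x \<in> topspace X. g x = f x}" "F \<subseteq> X closure_of (E \<union> H s)"
        unfolding P_def by blast
      \<comment> \<open>\<open>F\<close> lies in \<open>\<Union>s\<close>, which the closure of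
        \<open>H s\<close> misses.\<close>
      have "F \<subseteq> X closure_of E" using g(4) F(2) H(3)[OF s] by auto
      then show ?thesis using g by blast
    qed
    then show ?thesis using C(1,2) by blast
  qed
  then have "\<forall>p\<in>T. \<exists>C\<subseteq>A. countable C \<and>
      (\<forall>F. finite F \<and> F \<subseteq> (topspace X - N) \<inter> \<Union>(snd p) \<longrightarrow> (\<exists>g\<in>C. \<forall>x\<in>F \<union> fst p. g x = f x))"
    by force
  then obtain C where C: "\<And>p. p \<in> T \<Longrightarrow> C p \<subseteq> A \<and> countable (C p) \<and>
      (\<forall>F. finite F \<and> F \<subseteq> (topspace X - N) \<inter> \<Union>(snd p) \<longrightarrow> (\<exists>g\<in>C p. \<forall>x\<in>F \<union> fst p. g x = f x))"
    by metis
  have "countable T"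
    unfolding T_def using countable_Collect_finite_subset[OF Nc] countable_Collect_finite_subset[OF Z(2)]
    by (rule countable_SIGMA)
  then have Cc: "countable (\<Union>(C ` T))" using C by blast
  have CA: "\<Union>(C ` T) \<subseteq> A" using C by blast
  then have CQ: "\<Union>(C ` T) \<subseteq> topspace (Qp X D2)" using A by blast
  have "f \<in> Qp X D2 closure_of (\<Union>(C ` T))"
    unfolding in_closure_of_Qp_D2_iff[OF f CQ]
  proof (intro allI impI, elim conjE)
    fix F assume F: "finite F" "F \<subseteq> topspace X"
    \<comment> \<open>\<open>F\<close> is split: \<open>F \<inter> N\<close> becomes the first
      index, and finitely many members of \<open>\<Z>\<close> covering \<open>F - N\<close> the
      second.\<close>
    have "finite (F - N)" "F - N \<subseteq> \<Union>\<Z>" using F Zcov by auto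
    then obtain s where s: "finite s" "s \<subseteq> \<Z>" "F - N \<subseteq> \<Union>s" by (rule finite_subset_Union)
    have p: "(F \<inter> N, s) \<in> T" unfolding T_def using F(1) s by auto
    have "finite (F - N) \<and> F - N \<subseteq> (topspace X - N) \<inter> \<Union>(snd (F \<inter> N, s))" using F s by auto
    from C[OF p, THEN conjunct2, THEN conjunct2, rule_format, OF this]
    obtain g where "g \<in> C (F \<inter> N, s)" "\<forall>x\<in>(F - N) \<union> fst (F \<inter> N, s). g x = f x"
      by (elim bexE)
    then show "\<exists>g\<in>\<Union>(C ` T). \<forall>x\<in>F. g x = f x" using p by (intro bexI[of _ g]) auto
  qed
  then show "\<exists>B\<subseteq>A. countable B \<and> f \<in> Qp X D2 closure_of B" using Cc CA by blast
qed

end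

section \<open>The five equivalent conditions\<close>

theorem theorem3p6:
  fixes X :: "'a topology"
  assumes "regular_space X" and "t1_space X"
    and "uncountable (topspace X)"
    and "open_whyburn X"
  shows "(P_Lindelof (Omega_s X) \<longleftrightarrow> P_Lindelof (K_Omega X))
       \<and> (P_Lindelof (K_Omega X) \<longleftrightarrow>
            countable_tightness_at (Qp X euclideanreal) (restrict (\<lambda>_. 0) (topspace X)))
       \<and> (countable_tightness_at (Qp X euclideanreal) (restrict (\<lambda>_. 0) (topspace X)) \<longleftrightarrow>
            (\<forall>f. continuous_map X euclideanreal f \<longrightarrow>
                 countable_tightness_at (Qp X euclideanreal) (restrict f (topspace X))))
       \<and> ((\<forall>f. continuous_map X euclideanreal f \<longrightarrow>
                 countable_tightness_at (Qp X euclideanreal) (restrict f (topspace X)))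
            \<longleftrightarrow> countable_tightness (Qp X D2))"
proof -
  interpret regular_open_whyburn X using assms by unfold_locales
  let ?K = "P_Lindelof (K_Omega X)"
  let ?tzero = "countable_tightness_at (Qp X euclideanreal) (restrict (\<lambda>_. 0) (topspace X))"
  let ?t = "\<forall>f. continuous_map X euclideanreal f \<longrightarrow>
                 countable_tightness_at (Qp X euclideanreal) (restrict f (topspace X))"
  \<comment> \<open>\<open>?K\<close> is the hub: it is equivalent to the condition on
    \<open>Omega_s\<close>, closes a cycle with \<open>?t\<close> and \<open>?tzero\<close>, and is
    equivalent to tightness over \<open>D2\<close>.\<close>
  have 1: "P_Lindelof (Omega_s X) \<longleftrightarrow> ?K"
    using Omega_s_Lindelof_imp_K_Omega_Lindelof K_Omega_Lindelof_imp_Omega_s_Lindelof by blast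
  have 2: "?K \<Longrightarrow> ?t" using K_Omega_Lindelof_imp_tightness_continuous by blast
  have 3: "?t \<Longrightarrow> ?tzero" by simp
  \<comment> \<open>\<open>{..<1}\<close> is an open set separating 0 from 1; over \<open>D2\<close>
    the singleton \<open>{0}\<close> plays this role.\<close>
  have 4: "?tzero \<Longrightarrow> ?K"
    by (rule countable_tightness_at_zero_imp_K_Omega_Lindelof[of euclideanreal "{..<1}"]) auto
  have 5: "?K \<Longrightarrow> countable_tightness (Qp X D2)" by (rule K_Omega_Lindelof_imp_tightness_D2)
  have 6: "?K" if "countable_tightness (Qp X D2)"
  proof (rule countable_tightness_at_zero_imp_K_Omega_Lindelof[of D2 "{0}"])
    have "restrict (\<lambda>_. 0) (topspace X) \<in> topspace (Qp X D2)"
      using quasicontinuous_const[of 0 D2 X] by (auto simp: topspace_Qp D2_def)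
    then show "countable_tightness_at (Qp X D2) (restrict (\<lambda>_. 0) (topspace X))"
      using that unfolding countable_tightness_def by blast
  qed (auto simp: D2_def)
  have K0: "?K \<longleftrightarrow> ?tzero" by (rule iffI[OF 3[OF 2] 4])
  have Kt: "?K \<longleftrightarrow> ?t" by (rule iffI[OF 2 4[OF 3]])
  have K5: "?K \<longleftrightarrow> countable_tightness (Qp X D2)" by (rule iffI[OF 5 6])
  show ?thesis
    by (intro conjI 1 K0 trans[OF K0[symmetric] Kt] trans[OF Kt[symmetric] K5])
qed

end
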